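(* Let $n\ge 3$ and let $A=(a_{ij})\in\mathbb{C}^{n\times n}$ be irreducible with $A\in GDE_n$. Then $\rho(H_{FGS})<1$ (i.e., the sequence $\{x^{(i)}\}$ generated by the FGS scheme converges to the unique solution of $Ax=b$ for any choice of the initial guess $x^{(0)}$) if and only if $D_A^{-1}A\notin \mathscr{U}^{\psi}_n$ for every $\psi\in\mathbb{R}$.
   Context: $GDE_n$ is the set of $n\times n$ complex matrices that are generalized diagonally equipotent: there exist positive constants $\alpha_1,\dots,\alpha_n$ with $\alpha_i|a_{ii}|=\sum_{j\ne i}\alpha_j|a_{ij}|$ for all $i$ (as literally printed in the paper's definition). For $A$ with all $a_{ii}\neq 0$ (automatic for irreducible $A\in GDE_n$, $n\ge 2$), write $A=D_A-L_A-U_A$ with $D_A=\mathrm{diag}(a_{11},\dots,a_{nn})$, $L_A$ strictly lower triangular, $U_A$ strictly upper triangular. The forward Gauss-Seidel (FGS) iteration matrix is $H_{FGS}=(D_A-L_A)^{-1}U_A$, and the FGS scheme for $Ax=b$ is $x^{(i+1)}=H_{FGS}x^{(i)}+(D_A-L_A)^{-1}b$, $i=0,1,2,\dots$. $\rho$ denotes the spectral radius. A matrix $(e^{i\psi_{rs}})\in\mathbb{C}^{n\times n}$ ($\psi_{rs}\in\mathbb{R}$, $i=\sqrt{-1}$) is a $\psi$-ray pattern matrix ($\psi\in\mathbb{R}$) if, modulo $2\pi$: (1) $\psi_{rs}+\psi_{sr}\equiv\psi$ for all $r\ne s$; (2) $\psi_{rs}-\psi_{rt}\equiv\psi_{ts}+\pi$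 whenever $r<s<t$ or $s<t<r$ or $t<r<s$; (3) $\psi_{rs}-\psi_{rt}\equiv\psi_{ts}-\psi+\pi$ whenever $r<t<s$ or $t<s<r$ or $s<r<t$; (4) $\psi_{rr}=0$ for all $r$. $\mathscr{U}^{\psi}_n$ is the set of $n\times n$ complex matrices $B=(b_{rs})$ for which there exist $\eta\in\mathbb{R}$ and a $\psi$-ray pattern matrix $(e^{i\psi_{rs}})$ with $b_{rs}=e^{i\eta}|b_{rs}|e^{i\psi_{rs}}$ for all $r,s$. *)

theory Defs
  imports
    "HOL-Library.Real_Mod"
    "HOL-Combinatorics.Permutations"
    "Jordan_Normal_Form.Spectral_Radius"
    "Jordan_Normal_Form.Gauss_Jordan_Elimination"
begin

text \<open>All \<open>n \<times> n\<close> matrices have index set \<open>{0..<n}\<close>, in place of \<open>{1..n}\<close>.\<close>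

text \<open>For a permutation matrix \<open>P\<close>, \<open>P A P\<^sup>T\<close> is the matrix with entries
  \<open>A $$ (p i, p j)\<close> for the corresponding permutation \<open>p\<close>.\<close>

definition reducible_mat :: "nat \<Rightarrow> complex mat \<Rightarrow> bool" where
  "reducible_mat n A \<longleftrightarrow>
     (\<exists>p r A11 A12 A22. p permutes {0..<n} \<and> 0 < r \<and> r < n \<and>
        A11 \<in> carrier_mat r r \<and> A12 \<in> carrier_mat r (n - r) \<and>
        A22 \<in> carrier_mat (n - r) (n - r) \<and>
        mat n n (\<lambda>(i, j). A $$ (p i, p j)) = four_block_mat A11 A12 (0\<^sub>m (n - r) r) A22)"

text \<open>Used only for \<open>n \<ge> 2\<close>; the usual exception for the \<open>1 \<times> 1\<close> zero matrix is not built in.\<close>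

definition irreducible_mat :: "nat \<Rightarrow> complex mat \<Rightarrow> bool" where
  "irreducible_mat n A \<longleftrightarrow> A \<in> carrier_mat n n \<and> \<not> reducible_mat n A"

definition GDE :: "nat \<Rightarrow> complex mat set" where
  "GDE n = {A \<in> carrier_mat n n. \<exists>\<alpha> :: nat \<Rightarrow> real. (\<forall>i<n. \<alpha> i > 0) \<and>
     (\<forall>i<n. \<alpha> i * cmod (A $$ (i, i)) = (\<Sum>j\<in>{0..<n} - {i}. \<alpha> j * cmod (A $$ (i, j))))}"

definition diag_part :: "complex mat \<Rightarrow> complex mat" where
  "diag_part A = mat (dim_row A) (dim_col A) (\<lambda>(i, j). if i = j then A $$ (i, j) else 0)"

text \<open>The minus signs give the splitting \<open>A = D\<^sub>A - L\<^sub>A - U\<^sub>A\<close>.\<close>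

definition lower_part :: "complex mat \<Rightarrow> complex mat" where
  "lower_part A = mat (dim_row A) (dim_col A) (\<lambda>(i, j). if j < i then - A $$ (i, j) else 0)"

definition upper_part :: "complex mat \<Rightarrow> complex mat" where
  "upper_part A = mat (dim_row A) (dim_col A) (\<lambda>(i, j). if i < j then - A $$ (i, j) else 0)"

text \<open>Meaningful only for invertible arguments.\<close>

abbreviation inv_mat :: "complex mat \<Rightarrow> complex mat" where
  "inv_mat M \<equiv> the (mat_inverse M)"

definition H_FGS :: "complex mat \<Rightarrow> complex mat" where
  "H_FGS A = inv_mat (diag_part A - lower_part A) * upper_part A"

primrec fgs_seq :: "complex mat \<Rightarrow> complex vec \<Rightarrow> complex vec \<Rightarrow> nat \<Rightarrow> complex vec" where
  "fgs_seq A b x0 0 = x0"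
| "fgs_seq A b x0 (Suc k) =
     H_FGS A *\<^sub>v fgs_seq A b x0 k + inv_mat (diag_part A - lower_part A) *\<^sub>v b"

text \<open>\<open>A x = b\<close> has a unique solution, and the scheme converges to it (entrywise) from every
  initial guess.\<close>

definition fgs_converges :: "nat \<Rightarrow> complex mat \<Rightarrow> complex vec \<Rightarrow> bool" where
  "fgs_converges n A b \<longleftrightarrow>
     (\<exists>x\<in>carrier_vec n. (\<forall>y\<in>carrier_vec n. A *\<^sub>v y = b \<longleftrightarrow> y = x) \<and>
        (\<forall>x0\<in>carrier_vec n. \<forall>i<n. (\<lambda>k. fgs_seq A b x0 k $ i) \<longlonglongrightarrow> x $ i))"

definition ray_pattern_mat :: "nat \<Rightarrow> real \<Rightarrow> complex mat \<Rightarrow> bool" where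
  "ray_pattern_mat n \<psi> R \<longleftrightarrow> (\<exists>p :: nat \<Rightarrow> nat \<Rightarrow> real.
     R = mat n n (\<lambda>(r, s). cis (p r s)) \<and>
     (\<forall>r<n. \<forall>s<n. r \<noteq> s \<longrightarrow> [p r s + p s r = \<psi>] (rmod 2 * pi)) \<and>
     (\<forall>r<n. \<forall>s<n. \<forall>t<n. (r < s \<and> s < t) \<or> (s < t \<and> t < r) \<or> (t < r \<and> r < s) \<longrightarrow>
        [p r s - p r t = p t s + pi] (rmod 2 * pi)) \<and>
     (\<forall>r<n. \<forall>s<n. \<forall>t<n. (r < t \<and> t < s) \<or> (t < s \<and> s < r) \<or> (s < r \<and> r < t) \<longrightarrow>
        [p r s - p r t = p t s - \<psi> + pi] (rmod 2 * pi)) \<and>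
     (\<forall>r<n. [p r r = 0] (rmod 2 * pi)))"

definition ray_class :: "nat \<Rightarrow> real \<Rightarrow> complex mat set" where
  "ray_class n \<psi> = {B \<in> carrier_mat n n. \<exists>\<eta> :: real. \<exists>R. ray_pattern_mat n \<psi> R \<and>
     (\<forall>r<n. \<forall>s<n. B $$ (r, s) = cis \<eta> * complex_of_real (cmod (B $$ (r, s))) * R $$ (r, s))}"

end

theory Submission
  imports Defs
begin

text \<open>
  Write \<open>\<alpha>\<close> for the weights of generalized diagonal equipotence. An eigenvector \<open>v\<close> of the
  Gauss-Seidel matrix for \<open>\<lambda>\<close> satisfies \<open>- a\<^sub>i\<^sub>i v\<^sub>i = (\<Sum>j\<noteq>i. c\<^sub>i\<^sub>j a\<^sub>i\<^sub>j v\<^sub>j)\<close> with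
  \<open>c\<^sub>i\<^sub>j = \<lambda>\<inverse>\<close> above the diagonal and \<open>c\<^sub>i\<^sub>j = 1\<close> below. If \<open>\<bar>\<lambda>\<bar> \<ge> 1\<close>, then in every row where
  \<open>\<bar>v\<^sub>i\<bar> / \<alpha>\<^sub>i\<close> is maximal the triangle inequality is an equality, so the maximum propagates to all
  neighbours and, by irreducibility, to all indices. Hence \<open>\<bar>\<lambda>\<bar> = 1\<close> and the phases of \<open>A\<close> are
  determined by those of \<open>v\<close> and \<open>\<lambda>\<close>; this phase condition, which conversely yields an eigenvector
  with entries of modulus \<open>\<alpha>\<^sub>i\<close>, is membership in the ray class with \<open>\<psi> = arg \<lambda>\<close>.
\<close>

section \<open>Equality in the triangle inequality, and irreducibility\<close>

text \<open>Rotate so that the sum points along the positive real axis. Each real part is at most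
  \<open>t j\<close>, yet the real parts add up to the sum of all \<open>t j\<close>, so every one
  of them attains its bound. A number whose modulus does not exceed its real part is a nonnegative
  real.\<close>

lemma triangle_equality:
  fixes z :: "'a \<Rightarrow> complex"
  assumes "finite I" and le: "\<And>j. j \<in> I \<Longrightarrow> cmod (z j) \<le> t j"
    and eq: "cmod (\<Sum>j\<in>I. z j) = (\<Sum>j\<in>I. t j)" and j: "j \<in> I"
  shows "z j = of_real (t j) * sgn (\<Sum>j\<in>I. z j)"
proof (cases "(\<Sum>j\<in>I. z j) = 0")
  \<comment> \<open>All bounds are nonnegative and add up to 0, so they vanish, and with them every
    summand; the claim then agrees with \<open>sgn 0 = 0\<close>.\<close>
  case True
  have "t j = 0"
    using sum_nonneg_eq_0_iff[OF \<open>finite I\<close>, of t] le norm_ge_zero order_trans eq True j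
    by (metis norm_zero)
  then show ?thesis using le[OF j] True by simp
next
  case False
  define w where "w = sgn (\<Sum>j\<in>I. z j)"
  have w: "w * cnj w = 1"
    using False by (simp add: w_def norm_sgn complex_norm_square[symmetric])
  have "(\<Sum>j\<in>I. z j) = of_real (cmod (\<Sum>j\<in>I. z j)) * w"
    using False by (simp add: w_def sgn_eq)
  then have "(\<Sum>j\<in>I. z j * cnj w) = of_real (cmod (\<Sum>j\<in>I. z j)) * (w * cnj w)"
    by (metis sum_distrib_right mult.assoc)
  then have "Re (\<Sum>j\<in>I. z j * cnj w) = (\<Sum>j\<in>I. t j)"
    unfolding w eq by simp
  then have "(\<Sum>j\<in>I. Re (z j * cnj w)) = (\<Sum>j\<in>I. t j)"
    by (simp only: Re_sum)
  moreover have cm: "cmod (z j * cnj w) \<le> t j" if "j \<in> I" for j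
    using le[OF that] False by (simp add: w_def norm_mult norm_sgn)
  moreover have "Re (z j * cnj w) \<le> t j" if "j \<in> I" for j
    using cm[OF that] complex_Re_le_cmod order_trans by blast
  ultimately have re: "Re (z j * cnj w) = t j"
    using sum_mono_inv[of "\<lambda>j. Re (z j * cnj w)" I t j] j \<open>finite I\<close> by auto
  then have "cmod (z j * cnj w) = Re (z j * cnj w)"
    using cm[OF j] complex_Re_le_cmod[of "z j * cnj w"] by linarith
  then have "Im (z j * cnj w) = 0"
    using cmod_power2[of "z j * cnj w"] by (metis add_cancel_right_right power_eq_0_iff zero_neq_numeral)
  then have "z j * cnj w = of_real (t j)"
    using re by (simp add: complex_eq_iff)
  then have "z j * (w * cnj w) = of_real (t j) * w"
    by (metis mult.assoc mult.commute)
  then show ?thesis unfolding w by (simp add: w_def)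
qed

text \<open>In the directed graph of the nonzero entries no edge leaves S. Numbering the complement
  of S first and S last moves the vanishing entries into the lower left block.\<close>

lemma reducible_matI:
  assumes A: "A \<in> carrier_mat n n" and S: "S \<subseteq> {0..<n}" "S \<noteq> {}" "S \<noteq> {0..<n}"
    and zero: "\<And>i j. i \<in> S \<Longrightarrow> j < n \<Longrightarrow> j \<notin> S \<Longrightarrow> A $$ (i, j) = 0"
  shows "reducible_mat n A"
proof -
  define r where "r = n - card S"
  have fin: "finite S" using S(1) finite_subset by blast
  have "card S < n" using psubset_card_mono[of "{0..<n}" S] S by auto
  moreover have "card S > 0" using fin S(2) by (simp add: card_gt_0_iff)
  ultimately have r: "0 < r" "r < n" by (auto simp: r_def)
  have "card {0..<r} = card ({0..<n} - S)"
    using fin S(1) by (simp add: card_Diff_subset r_def)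
  then obtain f where f: "bij_betw f {0..<r} ({0..<n} - S)"
    using finite_same_card_bij[of "{0..<r}" "{0..<n} - S"] by auto
  have "card {r..<n} = card S" using \<open>card S < n\<close> by (simp add: r_def)
  then obtain g where g: "bij_betw g {r..<n} S"
    using finite_same_card_bij[of "{r..<n}" S] fin by auto
  \<comment> \<open>Positions below r enumerate the complement of S, the later ones S; beyond n the
    map is the identity, as \<open>permutes\<close> demands.\<close>
  define p where "p i = (if i < r then f i else if i < n then g i else i)" for i
  have pf: "bij_betw p {0..<r} ({0..<n} - S)"
    using f by (rule bij_betw_cong[THEN iffD1, rotated]) (auto simp: p_def)
  have pg: "bij_betw p {r..<n} S"
    using g by (rule bij_betw_cong[THEN iffD1, rotated]) (auto simp: p_def)
  have "bij_betw p ({0..<r} \<union> {r..<n}) (({0..<n} - S) \<union> S)"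
    by (rule bij_betw_combine[OF pf pg]) auto
  moreover have "{0..<r} \<union> {r..<n} = {0..<n}" "({0..<n} - S) \<union> S = {0..<n}"
    using r S(1) by auto
  ultimately have perm: "p permutes {0..<n}"
    using r by (intro bij_imp_permutes) (auto simp: p_def)
  let ?M = "mat n n (\<lambda>(i, j). A $$ (p i, p j))"
  have "?M = four_block_mat (mat r r (\<lambda>(i, j). ?M $$ (i, j)))
     (mat r (n - r) (\<lambda>(i, j). ?M $$ (i, j + r))) (0\<^sub>m (n - r) r)
     (mat (n - r) (n - r) (\<lambda>(i, j). ?M $$ (i + r, j + r)))" (is "_ = ?F")
  proof (rule eq_matI)
    fix i j assume "i < dim_row ?F" "j < dim_col ?F"
    then have ij: "i < n" "j < n" using r by auto
    have "A $$ (p i, p j) = 0" if "\<not> i < r" "j < r"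
    proof (rule zero)
      show "p i \<in> S" using pg that ij by (auto simp: bij_betw_def)
      show "p j < n" "p j \<notin> S" using pf that ij by (auto simp: bij_betw_def)
    qed
    then show "?M $$ (i, j) = ?F $$ (i, j)"
      using ij r by auto
  qed (use r in auto)
  then show ?thesis
    unfolding reducible_mat_def using perm r
    by (intro exI[of _ p] exI[of _ r] exI conjI) auto
qed

text \<open>Otherwise the singleton \<open>{i}\<close>, a proper subset because n is at least 2,
  would have no outgoing edge.\<close>

lemma irreducible_row_nonzero:
  assumes "irreducible_mat n A" "n \<ge> 2" "i < n"
  shows "\<exists>j<n. j \<noteq> i \<and> A $$ (i, j) \<noteq> 0"
proof (rule ccontr)
  assume "\<not> ?thesis"
  moreover have "card {i} \<noteq> card {0..<n}" using assms(2) by simp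
  then have "{i} \<noteq> {0..<n}" by metis
  ultimately have "reducible_mat n A"
    using assms by (intro reducible_matI[of _ _ "{i}"]) (auto simp: irreducible_mat_def)
  then show False using assms by (simp add: irreducible_mat_def)
qed

text \<open>With positive weights, a zero diagonal entry makes the weighted sum of the other moduli
  in its row vanish, so the whole row is zero, contrary to irreducibility.\<close>

lemma irreducible_GDE_diag_nonzero:
  assumes irr: "irreducible_mat n A" and "n \<ge> 2" and "A \<in> GDE n"
  shows "\<forall>i<n. A $$ (i, i) \<noteq> 0"
proof (intro allI impI notI)
  fix i assume i: "i < n" and "A $$ (i, i) = 0"
  obtain \<alpha> :: "nat \<Rightarrow> real" where pos: "\<And>i. i < n \<Longrightarrow> \<alpha> i > 0"
    and "\<And>i. i < n \<Longrightarrow> \<alpha> i * cmod (A $$ (i, i)) = (\<Sum>j\<in>{0..<n} - {i}. \<alpha> j * cmod (A $$ (i, j)))"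
    using \<open>A \<in> GDE n\<close> by (auto simp: GDE_def)
  then have "(\<Sum>j\<in>{0..<n} - {i}. \<alpha> j * cmod (A $$ (i, j))) = 0"
    using i \<open>A $$ (i, i) = 0\<close> by fastforce
  moreover have "\<And>j. j \<in> {0..<n} - {i} \<Longrightarrow> \<alpha> j * cmod (A $$ (i, j)) \<ge> 0"
    using pos by (simp add: less_imp_le)
  ultimately have zero: "\<And>j. j \<in> {0..<n} - {i} \<Longrightarrow> \<alpha> j * cmod (A $$ (i, j)) = 0"
    using sum_nonneg_eq_0_iff[of "{0..<n} - {i}" "\<lambda>j. \<alpha> j * cmod (A $$ (i, j))"] by auto
  obtain j where j: "j < n" "j \<noteq> i" "A $$ (i, j) \<noteq> 0"
    using irreducible_row_nonzero[OF irr \<open>n \<ge> 2\<close> i] by blast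
  have "\<alpha> j * cmod (A $$ (i, j)) = 0" using j by (intro zero) simp
  then show False using pos[OF j(1)] j(3) by simp
qed

section \<open>The Gauss-Seidel splitting and its eigenvector equation\<close>

lemma inv_mat_inverse:
  assumes M: "M \<in> carrier_mat n n" and "det M \<noteq> 0"
  shows "inv_mat M \<in> carrier_mat n n" "M * inv_mat M = 1\<^sub>m n" "inv_mat M * M = 1\<^sub>m n"
proof -
  have "mat_inverse M \<noteq> None"
    using mat_inverse(1)[OF M, of "()"] det_non_zero_imp_unit[OF assms, of "()"] by blast
  then obtain B where "mat_inverse M = Some B" by auto
  with mat_inverse(2)[OF M this]
  show "inv_mat M \<in> carrier_mat n n" "M * inv_mat M = 1\<^sub>m n" "inv_mat M * M = 1\<^sub>m n"
    by auto
qed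

lemma mult_mat_vec_inverse_iff:
  assumes "M \<in> carrier_mat n n" "det M \<noteq> 0" "v \<in> carrier_vec n" "w \<in> carrier_vec n"
  shows "inv_mat M *\<^sub>v v = w \<longleftrightarrow> v = M *\<^sub>v w"
proof -
  note inv = inv_mat_inverse[OF assms(1,2)]
  have "M *\<^sub>v (inv_mat M *\<^sub>v v) = v" "inv_mat M *\<^sub>v (M *\<^sub>v w) = w"
    using inv assms by (simp_all flip: assoc_mult_mat_vec)
  then show ?thesis by metis
qed

text \<open>The matrix inverted by the scheme. The minus sign in \<open>lower_part\<close> makes it
  the lower triangle of A, diagonal included.\<close>

definition gs_lower :: "complex mat \<Rightarrow> complex mat" where
  "gs_lower A = diag_part A - lower_part A"

lemma gs_splitting_carrier:
  assumes "A \<in> carrier_mat n n"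
  shows "gs_lower A \<in> carrier_mat n n" "upper_part A \<in> carrier_mat n n"
  using assms by (auto simp: gs_lower_def diag_part_def lower_part_def upper_part_def)

lemma gs_lower_index:
  assumes "A \<in> carrier_mat n n" "i < n" "j < n"
  shows "gs_lower A $$ (i, j) = (if j \<le> i then A $$ (i, j) else 0)"
  using assms by (auto simp: gs_lower_def diag_part_def lower_part_def)

lemma det_gs_lower:
  assumes A: "A \<in> carrier_mat n n" and "\<forall>i<n. A $$ (i, i) \<noteq> 0"
  shows "det (gs_lower A) \<noteq> 0"
proof -
  have "det (gs_lower A) = prod_list (diag_mat (gs_lower A))"
    using gs_lower_index[OF A] gs_splitting_carrier[OF A]
    by (intro det_lower_triangular[of n]) auto
  also have "\<dots> \<noteq> 0"
    using assms gs_splitting_carrier[OF A]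
    by (auto simp: prod_list_zero_iff diag_mat_def gs_lower_index)
  finally show ?thesis .
qed

lemma H_FGS_carrier:
  assumes "A \<in> carrier_mat n n" "\<forall>i<n. A $$ (i, i) \<noteq> 0"
  shows "H_FGS A \<in> carrier_mat n n"
  using inv_mat_inverse(1)[OF gs_splitting_carrier(1) det_gs_lower, OF assms(1) assms]
    gs_splitting_carrier(2)[OF assms(1)]
  by (simp add: H_FGS_def gs_lower_def)

lemma upper_mult_vec:
  assumes "A \<in> carrier_mat n n" "v \<in> carrier_vec n"
  shows "upper_part A *\<^sub>v v = gs_lower A *\<^sub>v v - A *\<^sub>v v"
proof -
  have "upper_part A = gs_lower A - A"
    using assms gs_splitting_carrier[OF assms(1)]
    by (intro eq_matI) (auto simp: gs_lower_index upper_part_def)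
  then show ?thesis
    using assms gs_splitting_carrier[OF assms(1)] by (simp add: minus_mult_distrib_mat_vec)
qed

lemma eigenvector_H_FGS_iff:
  assumes A: "A \<in> carrier_mat n n" and d: "\<forall>i<n. A $$ (i, i) \<noteq> 0"
    and v: "v \<in> carrier_vec n"
  shows "H_FGS A *\<^sub>v v = l \<cdot>\<^sub>v v \<longleftrightarrow> upper_part A *\<^sub>v v = l \<cdot>\<^sub>v (gs_lower A *\<^sub>v v)"
proof -
  note car = gs_splitting_carrier[OF A] inv_mat_inverse(1)[OF gs_splitting_carrier(1)[OF A] det_gs_lower[OF A d]]
  have "H_FGS A *\<^sub>v v = inv_mat (gs_lower A) *\<^sub>v (upper_part A *\<^sub>v v)"
    unfolding H_FGS_def gs_lower_def[symmetric] using car v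
    by (simp add: assoc_mult_mat_vec[of _ n n _ n])
  also have "\<dots> = l \<cdot>\<^sub>v v \<longleftrightarrow> upper_part A *\<^sub>v v = gs_lower A *\<^sub>v (l \<cdot>\<^sub>v v)"
    using mult_mat_vec_inverse_iff[OF car(1) det_gs_lower[OF A d], of "upper_part A *\<^sub>v v" "l \<cdot>\<^sub>v v"] car v
    by auto
  finally show ?thesis using car v by (simp add: mult_mat_vec)
qed

text \<open>Row i of \<open>upper_part A *\<^sub>v v = l \<cdot>\<^sub>v (gs_lower A *\<^sub>v
  v)\<close>, divided by l and solved for the diagonal term. The division leaves the factor
  \<open>inverse l\<close> on the entries above the diagonal only.\<close>

lemma eigenvector_H_FGS_coord:
  assumes A: "A \<in> carrier_mat n n" and d: "\<forall>i<n. A $$ (i, i) \<noteq> 0"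
    and v: "v \<in> carrier_vec n" and "l \<noteq> 0"
  shows "H_FGS A *\<^sub>v v = l \<cdot>\<^sub>v v \<longleftrightarrow> (\<forall>i<n. - A $$ (i, i) * v $ i =
    (\<Sum>j\<in>{0..<n} - {i}. (if i < j then inverse l else 1) * A $$ (i, j) * v $ j))"
proof -
  have eq: "(upper_part A *\<^sub>v v) $ i = (l \<cdot>\<^sub>v (gs_lower A *\<^sub>v v)) $ i \<longleftrightarrow> - A $$ (i, i) * v $ i =
    (\<Sum>j\<in>{0..<n} - {i}. (if i < j then inverse l else 1) * A $$ (i, j) * v $ j)" if i: "i < n" for i
  proof -
    let ?c = "\<lambda>j. if i < j then inverse l else 1"
    have up: "(upper_part A *\<^sub>v v) $ i = (\<Sum>j\<in>{0..<n}. if i < j then - A $$ (i, j) * v $ j else 0)"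
      using A v i by (auto simp: upper_part_def scalar_prod_def intro!: sum.cong)
    have lo: "(gs_lower A *\<^sub>v v) $ i = (\<Sum>j\<in>{0..<n}. if j \<le> i then A $$ (i, j) * v $ j else 0)"
      using gs_splitting_carrier(1)[OF A] v i
      by (auto simp: scalar_prod_def gs_lower_index[OF A] intro!: sum.cong)
    have "(l \<cdot>\<^sub>v (gs_lower A *\<^sub>v v)) $ i - (upper_part A *\<^sub>v v) $ i
        = (\<Sum>j\<in>{0..<n}. l * (?c j * A $$ (i, j) * v $ j))"
      using i gs_splitting_carrier(1)[OF A] \<open>l \<noteq> 0\<close>
      by (subst index_smult_vec) (auto simp: up lo sum_distrib_left sum_subtractf[symmetric] intro!: sum.cong)
    also have "\<dots> = l * (A $$ (i, i) * v $ i + (\<Sum>j\<in>{0..<n} - {i}. ?c j * A $$ (i, j) * v $ j))"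
      using i by (simp add: sum_distrib_left[symmetric] sum.remove[of _ i])
    finally have "(l \<cdot>\<^sub>v (gs_lower A *\<^sub>v v)) $ i - (upper_part A *\<^sub>v v) $ i = \<dots>" .
    then show ?thesis using \<open>l \<noteq> 0\<close>
      by (metis (no_types, lifting) add_eq_0_iff eq_iff_diff_eq_0 minus_mult_left mult_eq_0_iff)
  qed
  have "H_FGS A *\<^sub>v v = l \<cdot>\<^sub>v v \<longleftrightarrow>
      (\<forall>i<n. (upper_part A *\<^sub>v v) $ i = (l \<cdot>\<^sub>v (gs_lower A *\<^sub>v v)) $ i)"
    unfolding eigenvector_H_FGS_iff[OF A d v] using gs_splitting_carrier[OF A] v
    by (metis carrier_matD(1) dim_mult_mat_vec eq_vecI index_smult_vec(2))
  then show ?thesis using eq by simp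
qed

section \<open>Eigenvalues of modulus at least one and the phase condition\<close>

text \<open>Here \<theta> stands for the arguments of an eigenvector and t for that of its
  eigenvalue. The condition says that in the coordinate equation every off-diagonal term of row i is
  a nonnegative multiple of \<open>- A $$ (i, i) * v $ i\<close>. Zero entries satisfy it
  trivially.\<close>

definition fgs_phases :: "nat \<Rightarrow> complex mat \<Rightarrow> (nat \<Rightarrow> real) \<Rightarrow> real \<Rightarrow> bool" where
  "fgs_phases n A \<theta> t \<longleftrightarrow> (\<forall>i<n. \<forall>j<n. i \<noteq> j \<longrightarrow>
     A $$ (i, j) / A $$ (i, i) = - of_real (cmod (A $$ (i, j) / A $$ (i, i))) *
       cis (\<theta> i - \<theta> j + (if i < j then t else 0)))"

lemma eigenvalue_H_FGS_phases:
  assumes irr: "irreducible_mat n A" and n: "n \<ge> 2" and GDE: "A \<in> GDE n"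
    and ev: "eigenvalue (H_FGS A) l" and l: "cmod l \<ge> 1"
  shows "\<exists>\<theta> t. fgs_phases n A \<theta> t"
proof -
  note d = irreducible_GDE_diag_nonzero[OF irr n GDE]
  have A: "A \<in> carrier_mat n n" using irr by (simp add: irreducible_mat_def)
  have "l \<noteq> 0" using l by auto
  obtain \<alpha> :: "nat \<Rightarrow> real" where pos: "\<And>i. i < n \<Longrightarrow> \<alpha> i > 0"
    and \<alpha>: "\<And>i. i < n \<Longrightarrow> \<alpha> i * cmod (A $$ (i, i)) = (\<Sum>j\<in>{0..<n} - {i}. \<alpha> j * cmod (A $$ (i, j)))"
    using GDE by (auto simp: GDE_def)
  obtain v where v: "v \<in> carrier_vec n" "v \<noteq> 0\<^sub>v n" and Hv: "H_FGS A *\<^sub>v v = l \<cdot>\<^sub>v v"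
    using ev H_FGS_carrier[OF A d] by (auto simp: eigenvalue_def eigenvector_def)
  define c where "c i j = (if i < j then inverse l else 1)" for i j :: nat
  have c: "cmod (c i j) \<le> 1" "c i j \<noteq> 0" for i j
    using l \<open>l \<noteq> 0\<close> by (auto simp: c_def norm_inverse inverse_le_1_iff)
  have eqn: "- A $$ (i, i) * v $ i = (\<Sum>j\<in>{0..<n} - {i}. c i j * A $$ (i, j) * v $ j)" if "i < n" for i
    using Hv that unfolding eigenvector_H_FGS_coord[OF A d v(1) \<open>l \<noteq> 0\<close>] c_def by blast
  \<comment> \<open>The largest modulus of the eigenvector relative to the weights; the rows
    attaining it are collected in S below.\<close>
  define m where "m = Max ((\<lambda>j. cmod (v $ j) / \<alpha> j) ` {0..<n})"
  have le: "cmod (v $ j) \<le> m * \<alpha> j" if "j < n" for j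
  proof -
    have "cmod (v $ j) / \<alpha> j \<le> m" unfolding m_def using that by (intro Max_ge) auto
    then show ?thesis using pos[OF that] by (simp add: pos_divide_le_eq)
  qed
  have "m \<in> (\<lambda>j. cmod (v $ j) / \<alpha> j) ` {0..<n}"
    unfolding m_def using n by (intro Max_in) auto
  then obtain i0 where i0: "i0 < n" "m = cmod (v $ i0) / \<alpha> i0" by auto
  then have i0: "i0 < n" "cmod (v $ i0) = m * \<alpha> i0" using pos[OF i0(1)] by auto
  have "m > 0"
  proof -
    obtain k where k: "k < n" "v $ k \<noteq> 0"
      using v by (metis eq_vecI carrier_vecD index_zero_vec)
    then have "0 < m * \<alpha> k" using le[of k] by (metis order_less_le_trans zero_less_norm_iff)
    then show ?thesis using pos[OF k(1)] by (simp add: zero_less_mult_iff)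
  qed
  define S where "S = {i. i < n \<and> cmod (v $ i) = m * \<alpha> i}"
  have term_le: "cmod (c i j * A $$ (i, j) * v $ j) \<le> m * \<alpha> j * cmod (A $$ (i, j))" if "j < n" for i j
  proof -
    have "cmod (c i j * A $$ (i, j) * v $ j) = cmod (A $$ (i, j)) * (cmod (c i j) * cmod (v $ j))"
      by (simp add: norm_mult)
    also have "\<dots> \<le> cmod (A $$ (i, j)) * (1 * (m * \<alpha> j))"
      using c le[OF that] by (intro mult_left_mono mult_mono) auto
    finally show ?thesis by (simp add: mult_ac)
  qed
  \<comment> \<open>In a row of S the left side of \<open>eqn\<close> has modulus
    \<open>m * (\<alpha> i * cmod (A $$ (i, i)))\<close>. By equipotence this is the sum of the
    bounds in \<open>term_le\<close>, so \<open>triangle_equality\<close> applies.\<close>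
  have extremal: "c i j * A $$ (i, j) * v $ j =
      of_real (m * \<alpha> j * cmod (A $$ (i, j))) * sgn (- A $$ (i, i) * v $ i)"
    if "i \<in> S" "j < n" "j \<noteq> i" for i j
  proof -
    have i: "i < n" "cmod (v $ i) = m * \<alpha> i" using that by (auto simp: S_def)
    have "cmod (\<Sum>j\<in>{0..<n} - {i}. c i j * A $$ (i, j) * v $ j) = m * (\<alpha> i * cmod (A $$ (i, i)))"
      unfolding eqn[OF i(1), symmetric] using i by (simp add: norm_mult)
    also have "\<dots> = (\<Sum>j\<in>{0..<n} - {i}. m * \<alpha> j * cmod (A $$ (i, j)))"
      unfolding \<alpha>[OF i(1)] by (simp add: sum_distrib_left mult_ac)
    finally show ?thesis
      unfolding eqn[OF i(1)] using term_le that by (intro triangle_equality) auto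
  qed
  have sgn1: "cmod (sgn (- A $$ (i, i) * v $ i)) = 1" if "i \<in> S" for i
  proof -
    have "v $ i \<noteq> 0" using that pos[of i] \<open>m > 0\<close> by (auto simp: S_def)
    then show ?thesis using d[rule_format, of i] that by (simp add: norm_sgn S_def)
  qed
  have sharp: "cmod (c i j) * cmod (v $ j) = m * \<alpha> j"
    if "i \<in> S" "j < n" "j \<noteq> i" "A $$ (i, j) \<noteq> 0" for i j
  proof -
    have "cmod (c i j * A $$ (i, j) * v $ j) = m * \<alpha> j * cmod (A $$ (i, j))"
      unfolding extremal[OF that(1-3)] using sgn1[OF that(1)] pos[OF that(2)] \<open>m > 0\<close>
      by (simp add: norm_mult)
    then show ?thesis using that by (simp add: norm_mult)
  qed
  \<comment> \<open>Since \<open>c i j\<close> has modulus at most 1, \<open>sharp\<close> forces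
    the maximum at every neighbour j of a row i in S. So no edge leaves S, and irreducibility leaves
    only the full index set.\<close>
  have "S = {0..<n}"
  proof (rule ccontr)
    assume "S \<noteq> {0..<n}"
    moreover have "j \<in> S" if "i \<in> S" "j < n" "A $$ (i, j) \<noteq> 0" for i j
    proof (cases "j = i")
      case False
      have "m * \<alpha> j \<le> 1 * cmod (v $ j)"
        unfolding sharp[OF that(1,2) False that(3), symmetric] using c by (intro mult_right_mono) auto
      then show ?thesis using le[OF that(2)] that by (simp add: S_def)
    qed (use that in simp)
    moreover have "i0 \<in> S" using i0 by (simp add: S_def)
    moreover have "S \<subseteq> {0..<n}" by (auto simp: S_def)
    ultimately have "reducible_mat n A"
      using A by (intro reducible_matI[of _ _ S]) auto
    then show False using irr by (simp add: irreducible_mat_def)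
  qed
  have v_norm: "cmod (v $ i) = m * \<alpha> i" "v $ i \<noteq> 0" if "i < n" for i
  proof -
    have "i \<in> S" using that \<open>S = {0..<n}\<close> by simp
    then show "cmod (v $ i) = m * \<alpha> i" by (simp add: S_def)
    then show "v $ i \<noteq> 0" using pos[OF that] \<open>m > 0\<close> by auto
  qed
  \<comment> \<open>All off-diagonal entries of row 0 lie above the diagonal, so a nonzero one
    carries the factor \<open>inverse l\<close>, whose modulus \<open>sharp\<close> shows to be
    1.\<close>
  have "cmod l = 1"
  proof -
    obtain j where j: "j < n" "j \<noteq> 0" "A $$ (0, j) \<noteq> 0"
      using irreducible_row_nonzero[OF irr n, of 0] n by auto
    then have "cmod (c 0 j) * cmod (v $ j) = cmod (v $ j)"
      using sharp[of 0 j] v_norm(1)[of j] \<open>S = {0..<n}\<close> by auto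
    then have "cmod (c 0 j) = 1" using v_norm(2)[OF j(1)] by simp
    then show ?thesis using j by (simp add: c_def norm_inverse)
  qed
  then have cis_l: "cis (Arg l) = l" using \<open>l \<noteq> 0\<close> by (simp add: cis_Arg sgn_eq)
  have cis_v: "of_real (m * \<alpha> i) * cis (Arg (v $ i)) = v $ i" if "i < n" for i
    using v_norm[OF that] by (simp add: cis_Arg sgn_eq flip: v_norm(1)[OF that])
  have "fgs_phases n A (\<lambda>i. Arg (v $ i)) (Arg l)"
    unfolding fgs_phases_def
  proof (intro allI impI)
    fix i j assume ij: "i < n" "j < n" "i \<noteq> j"
    have mj: "of_real (m * \<alpha> j) \<noteq> (0 :: complex)" using \<open>m > 0\<close> pos[OF ij(2)] by simp
    have "of_real (m * \<alpha> j) * (c i j * A $$ (i, j) * cis (Arg (v $ j))) = c i j * A $$ (i, j) * v $ j"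
      using cis_v[OF ij(2)] by (simp add: mult_ac)
    also have "\<dots> = of_real (m * \<alpha> j) * (- of_real (cmod (A $$ (i, j))) * sgn (A $$ (i, i)) * cis (Arg (v $ i)))"
      using ij \<open>S = {0..<n}\<close> v_norm(2)[OF ij(1)]
      by (subst extremal) (auto simp: sgn_mult sgn_minus cis_Arg)
    finally have eq: "c i j * A $$ (i, j) * cis (Arg (v $ j)) =
        - of_real (cmod (A $$ (i, j))) * sgn (A $$ (i, i)) * cis (Arg (v $ i))"
      using mj mult_left_cancel by blast
    have sg: "sgn (A $$ (i, i)) = A $$ (i, i) / of_real (cmod (A $$ (i, i)))" by (simp add: sgn_eq)
    have ci: "inverse (c i j) = cis (if i < j then Arg l else 0)" using cis_l by (simp add: c_def)
    have "c i j * inverse (c i j) = 1" using c(2)[of i j] by simp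
    moreover have "cis (Arg (v $ j)) * cis (- Arg (v $ j)) = 1" unfolding cis_mult by simp
    \<comment> \<open>Inserting two products equal to 1 exhibits the left side of \<open>eq\<close>,
      which is thereby solved for the entry.\<close>
    ultimately have "A $$ (i, j) = A $$ (i, j) * (c i j * inverse (c i j)) *
        (cis (Arg (v $ j)) * cis (- Arg (v $ j)))"
      by (simp only: mult_1_right)
    also have "\<dots> = (c i j * A $$ (i, j) * cis (Arg (v $ j))) * inverse (c i j) * cis (- Arg (v $ j))"
      by (simp only: mult_ac)
    also have "\<dots> = - of_real (cmod (A $$ (i, j))) * sgn (A $$ (i, i)) *
        (cis (Arg (v $ i)) * cis (- Arg (v $ j)) * cis (if i < j then Arg l else 0))"
      unfolding eq ci by (simp add: mult_ac)
    also have "\<dots> = A $$ (i, i) * (- of_real (cmod (A $$ (i, j) / A $$ (i, i))) *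
        cis (Arg (v $ i) - Arg (v $ j) + (if i < j then Arg l else 0)))"
      by (simp add: cis_mult sg norm_divide)
    finally show "A $$ (i, j) / A $$ (i, i) = - of_real (cmod (A $$ (i, j) / A $$ (i, i))) *
        cis (Arg (v $ i) - Arg (v $ j) + (if i < j then Arg l else 0))"
      using d[rule_format, OF ij(1)] by (simp add: nonzero_divide_eq_eq mult_ac)
  qed
  then show ?thesis by blast
qed

text \<open>The eigenvector has moduli \<alpha> and phases \<theta>. Above the diagonal the factor
  \<open>inverse (cis t)\<close> cancels the t of the phase condition, so all off-diagonal terms of
  row i are aligned with \<open>- A $$ (i, i) * v $ i\<close>, and equipotence makes their moduli
  add up correctly.\<close>

lemma phases_eigenvalue_H_FGS:
  assumes irr: "irreducible_mat n A" and n: "n \<ge> 2" and GDE: "A \<in> GDE n"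
    and ph: "fgs_phases n A \<theta> t"
  shows "eigenvalue (H_FGS A) (cis t)"
proof -
  note d = irreducible_GDE_diag_nonzero[OF irr n GDE]
  have A: "A \<in> carrier_mat n n" using irr by (simp add: irreducible_mat_def)
  obtain \<alpha> :: "nat \<Rightarrow> real" where pos: "\<And>i. i < n \<Longrightarrow> \<alpha> i > 0"
    and \<alpha>: "\<And>i. i < n \<Longrightarrow> \<alpha> i * cmod (A $$ (i, i)) = (\<Sum>j\<in>{0..<n} - {i}. \<alpha> j * cmod (A $$ (i, j)))"
    using GDE by (auto simp: GDE_def)
  define v where "v = vec n (\<lambda>j. of_real (\<alpha> j) * cis (\<theta> j))"
  have v: "v \<in> carrier_vec n" by (simp add: v_def)
  have "v $ 0 \<noteq> 0" using n pos[of 0] by (simp add: v_def)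
  then have v0: "v \<noteq> 0\<^sub>v n" using n by auto
  have "H_FGS A *\<^sub>v v = cis t \<cdot>\<^sub>v v"
    unfolding eigenvector_H_FGS_coord[OF A d v cis_neq_zero]
  proof (intro allI impI)
    fix i assume i: "i < n"
    \<comment> \<open>The unit direction of \<open>A $$ (i, i) * v $ i\<close>.\<close>
    define q where "q = A $$ (i, i) / of_real (cmod (A $$ (i, i))) * cis (\<theta> i)"
    have "(if i < j then inverse (cis t) else 1) * A $$ (i, j) * v $ j =
        - q * of_real (\<alpha> j * cmod (A $$ (i, j)))" if j: "j \<in> {0..<n} - {i}" for j
    proof -
      let ?s = "if i < j then t else 0"
      have "A $$ (i, j) = A $$ (i, i) * (- of_real (cmod (A $$ (i, j) / A $$ (i, i))) *
          cis (\<theta> i - \<theta> j + ?s))"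
        using ph i j d[rule_format, OF i] unfolding fgs_phases_def by (simp add: nonzero_divide_eq_eq mult_ac)
      then have "(if i < j then inverse (cis t) else 1) * A $$ (i, j) * v $ j =
          cis (- ?s) * (A $$ (i, i) * (- of_real (cmod (A $$ (i, j) / A $$ (i, i))) *
          cis (\<theta> i - \<theta> j + ?s))) * (of_real (\<alpha> j) * cis (\<theta> j))"
        using j by (auto simp: v_def)
      also have "\<dots> = - (A $$ (i, i) / of_real (cmod (A $$ (i, i)))) * of_real (\<alpha> j * cmod (A $$ (i, j)))
          * (cis (- ?s) * cis (\<theta> i - \<theta> j + ?s) * cis (\<theta> j))"
        by (simp add: norm_divide)
      also have "cis (- ?s) * cis (\<theta> i - \<theta> j + ?s) * cis (\<theta> j) = cis (\<theta> i)"
        by (simp only: cis_mult) simp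
      finally show ?thesis by (simp add: q_def mult_ac)
    qed
    then have "(\<Sum>j\<in>{0..<n} - {i}. (if i < j then inverse (cis t) else 1) * A $$ (i, j) * v $ j)
        = - q * of_real (\<Sum>j\<in>{0..<n} - {i}. \<alpha> j * cmod (A $$ (i, j)))"
      by (simp add: sum_distrib_left sum_negf)
    also have "\<dots> = - A $$ (i, i) * v $ i"
      unfolding \<alpha>[OF i, symmetric] using i d[rule_format, OF i] by (simp add: q_def v_def)
    finally show "- A $$ (i, i) * v $ i =
        (\<Sum>j\<in>{0..<n} - {i}. (if i < j then inverse (cis t) else 1) * A $$ (i, j) * v $ j)" ..
  qed
  then show ?thesis
    using v v0 H_FGS_carrier[OF A d] by (auto simp: eigenvalue_def eigenvector_def)
qed

section \<open>The phase condition as membership in the ray class\<close>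

text \<open>The diagonal matrix E of reciprocals is a left inverse of \<open>diag_part A\<close>.
  Hence the determinant is nonzero, and by uniqueness of inverses E is the matrix that
  \<open>inv_mat\<close> returns.\<close>

lemma diag_scaled_index:
  assumes A: "A \<in> carrier_mat n n" and d: "\<forall>i<n. A $$ (i, i) \<noteq> 0"
  shows "inv_mat (diag_part A) * A \<in> carrier_mat n n"
    and "i < n \<Longrightarrow> j < n \<Longrightarrow> (inv_mat (diag_part A) * A) $$ (i, j) = A $$ (i, j) / A $$ (i, i)"
proof -
  define E where "E = mat n n (\<lambda>(i, j). if i = j then inverse (A $$ (i, i)) else 0)"
  have D: "diag_part A \<in> carrier_mat n n" and E: "E \<in> carrier_mat n n"
    using A by (auto simp: diag_part_def E_def)
  have EX: "(E * X) $$ (i, j) = X $$ (i, j) / A $$ (i, i)"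
    if X: "X \<in> carrier_mat n n" and ij: "i < n" "j < n" for X i j
  proof -
    have "(E * X) $$ (i, j) = (\<Sum>k\<in>{0..<n}. E $$ (i, k) * X $$ (k, j))"
      using X E ij by (simp add: scalar_prod_def)
    also have "\<dots> = (\<Sum>k\<in>{0..<n}. if k = i then X $$ (i, j) / A $$ (i, i) else 0)"
      using ij by (intro sum.cong) (auto simp: E_def divide_inverse)
    finally show ?thesis using ij by simp
  qed
  have ED: "E * diag_part A = 1\<^sub>m n"
  proof (rule eq_matI)
    fix i j assume "i < dim_row (1\<^sub>m n :: complex mat)" "j < dim_col (1\<^sub>m n :: complex mat)"
    then have ij: "i < n" "j < n" by auto
    then show "(E * diag_part A) $$ (i, j) = 1\<^sub>m n $$ (i, j)"
      using d A by (simp add: EX[OF D ij]) (auto simp: diag_part_def)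
  qed (use D E in auto)
  then have "det E * det (diag_part A) = 1" using det_mult[OF E D] by simp
  then have "det (diag_part A) \<noteq> 0" by auto
  note inv = inv_mat_inverse[OF D this]
  have "E = E * (diag_part A * inv_mat (diag_part A))" using inv E by simp
  also have "\<dots> = inv_mat (diag_part A)"
    unfolding assoc_mult_mat[OF E D inv(1), symmetric] ED using inv(1) by simp
  finally have EI: "inv_mat (diag_part A) = E" ..
  show "inv_mat (diag_part A) * A \<in> carrier_mat n n" using A E by (simp add: EI)
  assume "i < n" "j < n"
  then show "(inv_mat (diag_part A) * A) $$ (i, j) = A $$ (i, j) / A $$ (i, i)"
    using EX[OF A] by (simp add: EI)
qed

lemma phases_imp_ray_class:
  assumes A: "A \<in> carrier_mat n n" and d: "\<forall>i<n. A $$ (i, i) \<noteq> 0"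
    and ph: "fgs_phases n A \<theta> t"
  shows "inv_mat (diag_part A) * A \<in> ray_class n t"
proof -
  \<comment> \<open>The summand \<open>pi\<close> absorbs the minus sign of
    \<open>fgs_phases\<close>; the diagonal is set to 0 for condition (4). Every congruence then
    holds with a discrepancy of at most one period.\<close>
  define p where "p r s = (if r = s then 0 else \<theta> r - \<theta> s + pi + (if r < s then t else 0))" for r s :: nat
  define R where "R = mat n n (\<lambda>(r, s). cis (p r s))"
  note B = diag_scaled_index[OF A d]
  have plus: "[a = b] (rmod 2 * pi)" if "a = b + 2 * pi" for a b
    unfolding rcong_altdef using that by (intro exI[of _ "-1"]) simp
  have minus: "[a = b] (rmod 2 * pi)" if "a = b - 2 * pi" for a b
    unfolding rcong_altdef using that by (intro exI[of _ "1"]) simp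
  have "ray_pattern_mat n t R"
    unfolding ray_pattern_mat_def
  proof (intro exI[of _ p] conjI allI impI)
    fix r s :: nat assume "r \<noteq> s"
    then show "[p r s + p s r = t] (rmod 2 * pi)" by (intro plus) (auto simp: p_def)
  next
    fix r s u :: nat assume "(r < s \<and> s < u) \<or> (s < u \<and> u < r) \<or> (u < r \<and> r < s)"
    then show "[p r s - p r u = p u s + pi] (rmod 2 * pi)"
      by (intro minus) (auto simp: p_def)
  next
    fix r s u :: nat assume "(r < u \<and> u < s) \<or> (u < s \<and> s < r) \<or> (s < r \<and> r < u)"
    then show "[p r s - p r u = p u s - t + pi] (rmod 2 * pi)"
      by (intro minus) (auto simp: p_def)
  qed (auto simp: R_def p_def)
  moreover have "(inv_mat (diag_part A) * A) $$ (r, s) =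
      cis 0 * of_real (cmod ((inv_mat (diag_part A) * A) $$ (r, s))) * R $$ (r, s)"
    if rs: "r < n" "s < n" for r s
  proof (cases "r = s")
    case True
    then show ?thesis using rs B(2)[OF rs] d by (simp add: R_def p_def)
  next
    case False
    then have "R $$ (r, s) = - cis (\<theta> r - \<theta> s + (if r < s then t else 0))"
      using rs by (simp add: R_def p_def minus_cis ac_simps)
    moreover have "A $$ (r, s) / A $$ (r, r) = - of_real (cmod (A $$ (r, s) / A $$ (r, r))) *
        cis (\<theta> r - \<theta> s + (if r < s then t else 0))"
      using ph rs False unfolding fgs_phases_def by blast
    ultimately show ?thesis unfolding B(2)[OF rs] by simp
  qed
  ultimately show ?thesis
    unfolding ray_class_def using B(1) by blast
qed

lemma ray_class_imp_phases:
  assumes A: "A \<in> carrier_mat n n" and d: "\<forall>i<n. A $$ (i, i) \<noteq> 0" and "n > 0"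
    and ray: "inv_mat (diag_part A) * A \<in> ray_class n \<psi>"
  shows "\<exists>\<theta>. fgs_phases n A \<theta> \<psi>"
proof -
  note B = diag_scaled_index[OF A d]
  obtain \<eta> R where "ray_pattern_mat n \<psi> R"
    and BR: "\<And>r s. r < n \<Longrightarrow> s < n \<Longrightarrow> (inv_mat (diag_part A) * A) $$ (r, s) =
      cis \<eta> * of_real (cmod ((inv_mat (diag_part A) * A) $$ (r, s))) * R $$ (r, s)"
    using ray unfolding ray_class_def by blast
  then obtain p where R: "R = mat n n (\<lambda>(r, s). cis (p r s))"
    and p1: "\<forall>r<n. \<forall>s<n. r \<noteq> s \<longrightarrow> [p r s + p s r = \<psi>] (rmod 2 * pi)"
    and p2: "\<forall>r<n. \<forall>s<n. \<forall>t<n. (r < s \<and> s < t) \<or> (s < t \<and> t < r) \<or> (t < r \<and> r < s) \<longrightarrow>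
        [p r s - p r t = p t s + pi] (rmod 2 * pi)"
    and p3: "\<forall>r<n. \<forall>s<n. \<forall>t<n. (r < t \<and> t < s) \<or> (t < s \<and> s < r) \<or> (s < r \<and> r < t) \<longrightarrow>
        [p r s - p r t = p t s - \<psi> + pi] (rmod 2 * pi)"
    and p4: "\<forall>r<n. [p r r = 0] (rmod 2 * pi)"
    unfolding ray_pattern_mat_def by (elim exE conjE) (rule that)
  note p1 = p1[rule_format] and p2 = p2[rule_format] and p3 = p3[rule_format] and p4 = p4[rule_format]
  \<comment> \<open>The entry at (0, 0) is 1 both in the scaled matrix and in R, which removes the
    global phase \<eta>.\<close>
  have "cis (p 0 0) = cis 0" using p4[OF \<open>n > 0\<close>] cis_eq_iff by blast
  then have \<eta>: "cis \<eta> = 1"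
    using BR[OF \<open>n > 0\<close> \<open>n > 0\<close>] B(2)[OF \<open>n > 0\<close> \<open>n > 0\<close>] d[rule_format, OF \<open>n > 0\<close>] \<open>n > 0\<close> by (simp add: R)
  \<comment> \<open>Column \<open>0\<close> fixes the phases; the pattern conditions with third index \<open>0\<close> give all other entries.\<close>
  define \<theta> where "\<theta> r = (if r = 0 then 0 else p r 0 + pi)" for r :: nat
  have col: "cis (p r 0) = - cis (\<theta> r)" if "0 < r" for r
    using that by (simp add: \<theta>_def minus_cis')
  have row: "cis (p 0 s) = - cis (\<psi> - \<theta> s)" if "0 < s" "s < n" for s
  proof -
    have "cis (p s 0 + p 0 s) = cis \<psi>" using p1[of s 0] that \<open>n > 0\<close> cis_eq_iff by blast
    then have "cis (p 0 s) = cis \<psi> * cis (- p s 0)"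
      by (simp add: cis_mult[symmetric] flip: cis_inverse) (simp add: field_simps)
    then show ?thesis using that by (simp add: \<theta>_def minus_cis cis_mult algebra_simps)
  qed
  have phase: "cis (p r s) = - cis (\<theta> r - \<theta> s + (if r < s then \<psi> else 0))"
    if rs: "r < n" "s < n" "r \<noteq> s" for r s
  proof -
    consider "s = 0" | "r = 0" | "0 < r" "r < s" | "0 < s" "s < r" using rs by linarith
    then show ?thesis
    proof cases
      case 1
      then show ?thesis using col rs by (simp add: \<theta>_def)
    next
      case 2
      then show ?thesis using row[of s] rs by (simp add: \<theta>_def algebra_simps)
    next
      \<comment> \<open>The order \<open>0 < r < s\<close> falls under condition (2) with third
        index 0. The next case, \<open>0 < s < r\<close>, falls under condition (3), whose extra
        \<open>- \<psi>\<close> cancels the \<psi> contributed by row 0.\<close>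
      case 3
      have "cis (p r s - p r 0) = cis (p 0 s + pi)" using p2[of r s 0] 3 rs cis_eq_iff by auto
      then have "cis (p r s) = cis (p r 0) * - cis (p 0 s)"
        by (simp add: minus_cis flip: cis_divide) (simp add: field_simps)
      then show ?thesis using col[of r] row[of s] 3 rs by (simp add: cis_mult algebra_simps)
    next
      case 4
      have "cis (p r s - p r 0) = cis (p 0 s - \<psi> + pi)" using p3[of r s 0] 4 rs cis_eq_iff by auto
      also have "\<dots> = - (cis (p 0 s) * cis (- \<psi>))"
        by (simp only: minus_cis[symmetric] cis_mult) simp
      finally have "cis (p r 0) * cis (p r s - p r 0) = cis (p r 0) * - (cis (p 0 s) * cis (- \<psi>))"
        by (rule arg_cong)
      moreover have "cis (p r 0) * cis (p r s - p r 0) = cis (p r s)"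
        unfolding cis_mult by simp
      ultimately have "cis (p r s) = cis (p r 0) * - (cis (p 0 s) * cis (- \<psi>))" by metis
      then show ?thesis using col[of r] row[of s] 4 rs by (simp add: cis_mult algebra_simps)
    qed
  qed
  have "fgs_phases n A \<theta> \<psi>"
    unfolding fgs_phases_def
  proof (intro allI impI)
    fix i j assume ij: "i < n" "j < n" "i \<noteq> j"
    show "A $$ (i, j) / A $$ (i, i) = - of_real (cmod (A $$ (i, j) / A $$ (i, i))) *
       cis (\<theta> i - \<theta> j + (if i < j then \<psi> else 0))"
      using BR[OF ij(1,2)] phase[OF ij] \<eta> ij unfolding B(2)[OF ij(1,2)] by (simp add: R)
  qed
  then show ?thesis by blast
qed

section \<open>Spectral radius and convergence of the iteration\<close>

lemma spectral_radius_less_iff: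
  assumes "H \<in> carrier_mat n n" "n > 0"
  shows "spectral_radius H < x \<longleftrightarrow> (\<forall>l. eigenvalue H l \<longrightarrow> cmod l < x)"
  using spectral_radius_mem_max[OF assms] by (force simp: spectrum_def)

lemma smult_mat_mult_vec:
  fixes H :: "complex mat"
  assumes "H \<in> carrier_mat n n" "v \<in> carrier_vec n"
  shows "(a \<cdot>\<^sub>m H) *\<^sub>v v = a \<cdot>\<^sub>v (H *\<^sub>v v)"
  using assms by (intro eq_vecI) auto

text \<open>Matrix powers are built by multiplication on the right, whereas the iteration multiplies
  on the left.\<close>

lemma pow_mat_commute:
  fixes H :: "complex mat"
  assumes "H \<in> carrier_mat n n"
  shows "H ^\<^sub>m k * H = H * H ^\<^sub>m k"
  using assms by (induction k) (auto simp: assoc_mult_mat[of _ n n _ n _ n])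

lemma spectral_radius_powers_tendsto_0:
  assumes H: "H \<in> carrier_mat n n" and n: "n > 0" and sr: "spectral_radius H < 1"
    and v: "v \<in> carrier_vec n" and i: "i < n"
  shows "(\<lambda>k. (H ^\<^sub>m k *\<^sub>v v) $ i) \<longlonglongrightarrow> 0"
proof -
  have "spectral_radius H \<ge> 0" using spectral_radius_mem_max(1)[OF H n] by auto
  \<comment> \<open>Scaling by \<open>inverse r\<close>, with r strictly between the spectral radius
    and 1, keeps the spectral radius below 1. The powers of the scaled matrix B are therefore
    bounded entrywise, so the entries of the powers of H are at most a constant times
    \<open>r ^ k\<close>.\<close>
  then obtain r where r: "spectral_radius H < r" "0 < r" "r < 1"
    using sr dense by (metis order_le_less_trans)
  define B where "B = of_real (inverse r) \<cdot>\<^sub>m H"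
  have B: "B \<in> carrier_mat n n" using H by (simp add: B_def)
  have "spectral_radius B < 1"
    unfolding spectral_radius_less_iff[OF B n]
  proof (intro allI impI)
    fix l assume "eigenvalue B l"
    then obtain u where u: "u \<in> carrier_vec n" "u \<noteq> 0\<^sub>v n" "B *\<^sub>v u = l \<cdot>\<^sub>v u"
      using B by (auto simp: eigenvalue_def eigenvector_def)
    have "H = of_real r \<cdot>\<^sub>m B" using r H by (auto simp: B_def)
    then have "H *\<^sub>v u = (of_real r * l) \<cdot>\<^sub>v u"
      using u(1) B by (simp add: smult_mat_mult_vec u(3) smult_smult_assoc)
    then have "eigenvalue H (of_real r * l)"
      using u H by (auto simp: eigenvalue_def eigenvector_def)
    then have "cmod (of_real r * l) < r"
      using spectral_radius_less_iff[OF H n] r(1) by blast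
    then show "cmod l < 1" using r by (simp add: norm_mult)
  qed
  then obtain c where c: "\<And>k. norm_bound (B ^\<^sub>m k) c"
    using spectral_radius_jnf_norm_bound_less_1_upper_triangular[OF B] by blast
  have pow: "B ^\<^sub>m k = of_real (inverse r ^ k) \<cdot>\<^sub>m H ^\<^sub>m k" for k
  proof (induction k)
    case 0
    then show ?case using H B by (auto simp: B_def)
  next
    case (Suc k)
    have "H ^\<^sub>m k \<in> carrier_mat n n" using H by simp
    then show ?case
      using Suc H by (auto simp: B_def mult_smult_distrib mult_smult_assoc_mat)
  qed
  have entry: "(\<lambda>k. (H ^\<^sub>m k) $$ (i, j)) \<longlonglongrightarrow> 0" if j: "j < n" for j
  proof (rule tendsto_0_le)
    show "(\<lambda>k. r ^ k) \<longlonglongrightarrow> 0" using r by (intro LIMSEQ_power_zero) auto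
    show "\<forall>\<^sub>F k in sequentially. cmod ((H ^\<^sub>m k) $$ (i, j)) \<le> norm (r ^ k) * c"
    proof (intro always_eventually allI)
      fix k
      have Hk: "H ^\<^sub>m k \<in> carrier_mat n n" using H by simp
      have "cmod ((B ^\<^sub>m k) $$ (i, j)) \<le> c"
        using c[of k] B i j unfolding norm_bound_def by (metis carrier_matD pow_carrier_mat)
      then have "inverse r ^ k * cmod ((H ^\<^sub>m k) $$ (i, j)) \<le> c"
        unfolding pow using Hk i j r by (subst (asm) index_smult_mat) (auto simp: norm_mult norm_power norm_inverse)
      then show "cmod ((H ^\<^sub>m k) $$ (i, j)) \<le> norm (r ^ k) * c"
        using r by (simp add: power_inverse divide_simps mult.commute)
    qed
  qed
  have "(\<lambda>k. \<Sum>j\<in>{0..<n}. (H ^\<^sub>m k) $$ (i, j) * v $ j) \<longlonglongrightarrow> (\<Sum>j\<in>{0..<n}. 0 * v $ j)"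
    using entry by (intro tendsto_sum tendsto_mult tendsto_const) auto
  moreover have "(H ^\<^sub>m k *\<^sub>v v) $ i = (\<Sum>j\<in>{0..<n}. (H ^\<^sub>m k) $$ (i, j) * v $ j)" for k
    using H v i by (simp add: scalar_prod_def)
  ultimately show ?thesis by simp
qed

text \<open>The solution x is a fixed point of the scheme, because \<open>upper_part A\<close> plus
  A equals \<open>gs_lower A\<close>; hence each step multiplies the error by
  \<open>H_FGS A\<close>.\<close>

lemma fgs_seq_error:
  assumes A: "A \<in> carrier_mat n n" and d: "\<forall>i<n. A $$ (i, i) \<noteq> 0"
    and x: "x \<in> carrier_vec n" and x0: "x0 \<in> carrier_vec n"
  shows "fgs_seq A (A *\<^sub>v x) x0 k = x + H_FGS A ^\<^sub>m k *\<^sub>v (x0 - x)"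
proof -
  note H = H_FGS_carrier[OF A d]
  note dt = det_gs_lower[OF A d]
  note car = gs_splitting_carrier[OF A] inv_mat_inverse(1)[OF gs_splitting_carrier(1)[OF A] dt]
  have Ux: "upper_part A *\<^sub>v x \<in> carrier_vec n" and Ax: "A *\<^sub>v x \<in> carrier_vec n"
    using car A x by auto
  have "H_FGS A *\<^sub>v x + inv_mat (gs_lower A) *\<^sub>v (A *\<^sub>v x)
      = inv_mat (gs_lower A) *\<^sub>v (upper_part A *\<^sub>v x + A *\<^sub>v x)"
    unfolding H_FGS_def gs_lower_def[symmetric] using car x Ux Ax
    by (simp add: assoc_mult_mat_vec[of _ n n _ n] mult_add_distrib_mat_vec[of _ n n])
  also have "\<dots> = x"
  proof (subst mult_mat_vec_inverse_iff[OF car(1) dt _ x])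
    show "upper_part A *\<^sub>v x + A *\<^sub>v x = gs_lower A *\<^sub>v x"
      unfolding upper_mult_vec[OF A x] using car(1) Ax A x by (intro eq_vecI) auto
  qed (use Ux Ax in auto)
  finally have fixed: "H_FGS A *\<^sub>v x + inv_mat (gs_lower A) *\<^sub>v (A *\<^sub>v x) = x" .
  show ?thesis
  proof (induction k)
    case 0
    then show ?case using H x x0 by (intro eq_vecI) auto
  next
    case (Suc k)
    let ?H = "H_FGS A" and ?e = "x0 - x"
    have Hk: "?H ^\<^sub>m k \<in> carrier_mat n n" and e: "?e \<in> carrier_vec n" using H x x0 by auto
    have "?H ^\<^sub>m Suc k *\<^sub>v ?e = ?H *\<^sub>v (?H ^\<^sub>m k *\<^sub>v ?e)"
      using H Hk e by (simp add: pow_mat_commute assoc_mult_mat_vec[of _ n n _ n])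
    moreover have "fgs_seq A (A *\<^sub>v x) x0 (Suc k) =
        (?H *\<^sub>v x + ?H *\<^sub>v (?H ^\<^sub>m k *\<^sub>v ?e)) + inv_mat (gs_lower A) *\<^sub>v (A *\<^sub>v x)"
      using mult_add_distrib_mat_vec[OF H x mult_mat_vec_carrier[OF Hk e]] Suc
      by (simp add: gs_lower_def)
    moreover have "\<dots> = (?H *\<^sub>v x + inv_mat (gs_lower A) *\<^sub>v (A *\<^sub>v x)) + ?H *\<^sub>v (?H ^\<^sub>m k *\<^sub>v ?e)"
      using H Hk e x car Ax by (intro eq_vecI) auto
    ultimately show ?case unfolding fixed by simp
  qed
qed

lemma fgs_converges_iff:
  assumes A: "A \<in> carrier_mat n n" and d: "\<forall>i<n. A $$ (i, i) \<noteq> 0" and n: "n > 0"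
    and b: "b \<in> carrier_vec n"
  shows "spectral_radius (H_FGS A) < 1 \<longleftrightarrow> fgs_converges n A b"
proof
  note H = H_FGS_carrier[OF A d]
  note err = fgs_seq_error[OF A d]
  {
    assume sr: "spectral_radius (H_FGS A) < 1"
    \<comment> \<open>A kernel vector of A would be an eigenvector of \<open>H_FGS A\<close> for the
      eigenvalue 1.\<close>
    have "det A \<noteq> 0"
    proof
      assume "det A = 0"
      then obtain v where v: "v \<in> carrier_vec n" "v \<noteq> 0\<^sub>v n" "A *\<^sub>v v = 0\<^sub>v n"
        using det_0_iff_vec_prod_zero[OF A] by auto
      have "upper_part A *\<^sub>v v = 1 \<cdot>\<^sub>v (gs_lower A *\<^sub>v v)"
        using upper_mult_vec[OF A v(1)] v gs_splitting_carrier[OF A] by (intro eq_vecI) auto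
      then have "eigenvalue (H_FGS A) 1"
        using eigenvector_H_FGS_iff[OF A d v(1), of 1] v H
        by (auto simp: eigenvalue_def eigenvector_def)
      then show False using sr spectral_radius_less_iff[OF H n] by fastforce
    qed
    define x where "x = inv_mat A *\<^sub>v b"
    have x: "x \<in> carrier_vec n"
      using inv_mat_inverse(1)[OF A \<open>det A \<noteq> 0\<close>] b by (simp add: x_def)
    have uniq: "A *\<^sub>v y = b \<longleftrightarrow> y = x" if "y \<in> carrier_vec n" for y
      using mult_mat_vec_inverse_iff[OF A \<open>det A \<noteq> 0\<close> b that] by (auto simp: x_def)
    have "(\<lambda>k. fgs_seq A b x0 k $ i) \<longlonglongrightarrow> x $ i" if x0: "x0 \<in> carrier_vec n" and i: "i < n" for x0 i
    proof -
      have "(\<lambda>k. x $ i + (H_FGS A ^\<^sub>m k *\<^sub>v (x0 - x)) $ i) \<longlonglongrightarrow> x $ i + 0"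
        using x x0 by (intro tendsto_add tendsto_const spectral_radius_powers_tendsto_0[OF H n sr _ i]) auto
      moreover have "fgs_seq A b x0 k $ i = x $ i + (H_FGS A ^\<^sub>m k *\<^sub>v (x0 - x)) $ i" for k
      proof -
        have "dim_vec (H_FGS A ^\<^sub>m k *\<^sub>v (x0 - x)) = n"
          using H by simp
        then show ?thesis
          using err[OF x x0, of k] uniq[OF x] i by (simp del: index_mult_mat_vec dim_mult_mat_vec)
      qed
      ultimately show ?thesis by simp
    qed
    then show "fgs_converges n A b"
      unfolding fgs_converges_def using x uniq by blast
  }
  assume "fgs_converges n A b"
  then obtain x where x: "x \<in> carrier_vec n" and Ax: "A *\<^sub>v x = b"
    and lim: "\<And>x0 i. x0 \<in> carrier_vec n \<Longrightarrow> i < n \<Longrightarrow> (\<lambda>k. fgs_seq A b x0 k $ i) \<longlonglongrightarrow> x $ i"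
    unfolding fgs_converges_def by blast
  show "spectral_radius (H_FGS A) < 1"
    unfolding spectral_radius_less_iff[OF H n]
  proof (intro allI impI)
    fix l assume "eigenvalue (H_FGS A) l"
    then obtain v where ev: "eigenvector (H_FGS A) v l" by (auto simp: eigenvalue_def)
    then have v: "v \<in> carrier_vec n" "v \<noteq> 0\<^sub>v n" using H by (auto simp: eigenvector_def)
    obtain i where i: "i < n" "v $ i \<noteq> 0"
      using v by (metis eq_vecI carrier_vecD index_zero_vec)
    \<comment> \<open>Starting at \<open>x + v\<close> with an eigenvector v makes the error exactly
      \<open>l ^ k \<cdot>\<^sub>v v\<close>. A coordinate where v is nonzero then shows that the
      powers of l tend to 0.\<close>
    have "(x + v) - x = v" using x v by (intro eq_vecI) auto
    then have "fgs_seq A b (x + v) k = x + l ^ k \<cdot>\<^sub>v v" for k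
      using err[OF x, of "x + v" k] eigenvector_pow[OF H ev] x v by (simp add: Ax)
    then have "(\<lambda>k. x $ i + l ^ k * v $ i) \<longlonglongrightarrow> x $ i"
      using lim[of "x + v" i] x v i by simp
    then have "(\<lambda>k. (x $ i + l ^ k * v $ i - x $ i) / v $ i) \<longlonglongrightarrow> (x $ i - x $ i) / v $ i"
      using i by (intro tendsto_intros)
    then have "(\<lambda>k. l ^ k) \<longlonglongrightarrow> 0" using i by simp
    then have "(\<lambda>k. cmod l ^ k) \<longlonglongrightarrow> 0"
      using tendsto_norm_zero by (force simp: norm_power)
    then have "\<forall>\<^sub>F k in sequentially. cmod l ^ k < 1"
      by (rule order_tendstoD(2)) simp
    then obtain k where "cmod l ^ k < 1" by (auto simp: eventually_sequentially)
    then show "cmod l < 1" by (meson not_le one_le_power)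
  qed
qed

theorem theorem4p11:
  fixes n :: nat and A :: "complex mat"
  assumes "n \<ge> 3"
    and "A \<in> carrier_mat n n"
    and "irreducible_mat n A"
    and "A \<in> GDE n"
  shows "(spectral_radius (H_FGS A) < 1 \<longleftrightarrow>
            (\<forall>\<psi> :: real. inv_mat (diag_part A) * A \<notin> ray_class n \<psi>)) \<and>
         (\<forall>b\<in>carrier_vec n. spectral_radius (H_FGS A) < 1 \<longleftrightarrow> fgs_converges n A b)"
proof -
  have n: "n \<ge> 2" "n > 0" using assms(1) by auto
  note A = assms(2)
  note d = irreducible_GDE_diag_nonzero[OF assms(3) n(1) assms(4)]
  have "spectral_radius (H_FGS A) < 1 \<longleftrightarrow> (\<forall>l. eigenvalue (H_FGS A) l \<longrightarrow> cmod l < 1)"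
    by (rule spectral_radius_less_iff[OF H_FGS_carrier[OF A d] n(2)])
  \<comment> \<open>An eigenvalue of modulus at least 1 yields phases; phases in turn yield the
    eigenvalue \<open>cis t\<close>, of modulus exactly 1.\<close>
  also have "\<dots> \<longleftrightarrow> (\<nexists>\<theta> t. fgs_phases n A \<theta> t)"
    using eigenvalue_H_FGS_phases[OF assms(3) n(1) assms(4)]
      phases_eigenvalue_H_FGS[OF assms(3) n(1) assms(4)]
    by (metis less_irrefl norm_cis not_le)
  also have "\<dots> \<longleftrightarrow> (\<forall>\<psi> :: real. inv_mat (diag_part A) * A \<notin> ray_class n \<psi>)"
    using phases_imp_ray_class[OF A d] ray_class_imp_phases[OF A d n(2)] by metis
  finally show ?thesis using fgs_converges_iff[OF A d n(2)] by blast
qed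

end
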